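(* Let $d\in\mathbb{N}$, let $(\mathbb{M},\mathbb{L},T)\in\mathcal{T}^d$ and let $S$ be a finite $d$-dimensional subset of $\mathbb{L}$. Consider the following conditions: (a) $S$ is $\mathbb{L}$-convex and each facet of the polytope $\mathrm{conv}(S)$ has a normal vector in $W(T,\mathbb{L})$. (b) $S\oplus T$ is $\mathbb{M}$-convex. (c) $S$ is $\mathbb{L}$-convex and each facet $F$ of $\mathrm{conv}(S)$ with $\mathrm{aff}(F)\subseteq F+\mathbb{L}$ has a normal vector in $W(T,\mathbb{L})$. Then the implications (a) $\Rightarrow$ (b) $\Rightarrow$ (c) hold.
   Context: $\mathbb{N}=\{1,2,3,\ldots\}$; $o$ is the origin of $\mathbb{R}^d$; $\langle\cdot,\cdot\rangle$ is the standard scalar product; $X+Y=\{x+y: x\in X,\ y\in Y\}$ is the Minkowski sum. The dimension of $X\subseteq\mathbb{R}^d$ is the maximal number of affinely independent points in $X$ minus $1$. $\mathrm{conv}$ and $\mathrm{aff}$ denote convex and affine hull. The sum $X+Y$ is called direct, and is then written $X\oplus Y$, if each $z\in X+Y$ has a unique representation $z=x+y$ with $x\in X$, $y\in Y$. A lattice of rank $i$ in $\mathbb{R}^d$ is a set $\mathbb{Z}b_1+\cdots+\mathbb{Z}b_i$ with $b_1,\ldots,b_i$ linearly independent. For a lattice $\mathbb{M}$ of rank $d$ in $\mathbb{R}^d$, a subset $K\subseteq\mathbb{M}$ is $\mathbb{M}$-convex if $K=C\cap\mathbb{M}$ for some convex $C\subseteq\mathbb{R}^d$. $\mathcal{T}^d$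 is the set of all triples $(\mathbb{M},\mathbb{L},T)$ such that $\mathbb{M}$ and $\mathbb{L}$ are lattices of rank $d$ in $\mathbb{R}^d$ with $\mathbb{L}\subseteq\mathbb{M}$, $T$ is a nonempty finite $\mathbb{M}$-convex set, and $\mathbb{M}=\mathbb{L}\oplus T$. (Since $S\subseteq\mathbb{L}$, the sum of $S$ and $T$ is direct.) The dual lattice is $\mathbb{L}^\ast=\{y\in\mathbb{R}^d:\langle y,x\rangle\in\mathbb{Z}\text{ for each }x\in\mathbb{L}\}$. The width function is $w(K,u)=\sup_{x\in K}\langle u,x\rangle-\inf_{x\in K}\langle u,x\rangle$, and $W(K,\mathbb{L})=\{u\in\mathbb{L}^\ast\setminus\{o\}: w(K,u)<1\}$. *)

theory Defs
  imports "HOL-Analysis.Analysis"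
begin

text \<open>
  Minkowski sums \<open>X + Y\<close> of sets are those of \<^theory>\<open>HOL-Library.Set_Algebras\<close>.
\<close>

definition direct_sum :: "'a::plus set \<Rightarrow> 'a set \<Rightarrow> bool"
  where "direct_sum X Y \<longleftrightarrow> (\<forall>z \<in> X + Y. \<exists>!(x, y). x \<in> X \<and> y \<in> Y \<and> z = x + y)"

definition lattice_of_rank :: "nat \<Rightarrow> 'a::euclidean_space set \<Rightarrow> bool"
  where "lattice_of_rank i L \<longleftrightarrow>
    (\<exists>B. finite B \<and> independent B \<and> card B = i \<and>
      L = {(\<Sum>b\<in>B. of_int (c b) *\<^sub>R b) | c :: 'a \<Rightarrow> int. True})"

definition lattice_convex :: "'a::real_vector set \<Rightarrow> 'a set \<Rightarrow> bool"
  where "lattice_convex M K \<longleftrightarrow> (\<exists>C. convex C \<and> K = C \<inter> M)"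

definition tiling_triples :: "((real ^ 'n) set \<times> (real ^ 'n) set \<times> (real ^ 'n) set) set"
  where "tiling_triples = {(M, L, T).
    lattice_of_rank CARD('n) M \<and> lattice_of_rank CARD('n) L \<and> L \<subseteq> M \<and>
    T \<noteq> {} \<and> finite T \<and> lattice_convex M T \<and>
    direct_sum L T \<and> M = L + T}"

definition dual_lattice :: "'a::real_inner set \<Rightarrow> 'a set"
  where "dual_lattice L = {y. \<forall>x\<in>L. y \<bullet> x \<in> \<int>}"

text \<open>
  The supremum and infimum are real-valued, so the following is the width only for nonempty
  bounded \<open>K\<close>.
\<close>

definition width :: "'a::real_inner set \<Rightarrow> 'a \<Rightarrow> real"
  where "width K u = (SUP x\<in>K. u \<bullet> x) - (INF x\<in>K. u \<bullet> x)"

definition small_width_dual :: "'a::real_inner set \<Rightarrow> 'a set \<Rightarrow> 'a set"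
  where "small_width_dual K L = {u \<in> dual_lattice L - {0}. width K u < 1}"

text \<open>
  No orientation (inner or outer) is prescribed for a normal vector of a facet. This makes no
  difference for membership in \<^const>\<open>small_width_dual\<close>, a set that is closed under negation.
\<close>

definition normal_vector :: "'a::real_inner set \<Rightarrow> 'a \<Rightarrow> bool"
  where "normal_vector F u \<longleftrightarrow> u \<noteq> 0 \<and> (\<forall>x\<in>F. \<forall>y\<in>F. u \<bullet> (x - y) = 0)"

end

theory Submission
  imports Defs
begin

text \<open>
  Both implications compare, for a facet \<open>F\<close> of \<open>conv S\<close>, the values that a normal vector \<open>u\<close>
  of \<open>F\<close> in the dual lattice of \<open>L\<close> takes on \<open>S\<close> and on \<open>T\<close>. On \<open>L\<close>, hence on \<open>S\<close>, these values
  are integers; on \<open>T\<close> they spread over an interval of length \<open>w(T,u)\<close>, so everything depends on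
  whether this length reaches the distance 1 of consecutive integers.

  Suppose that every facet has a normal vector in \<open>W(T,L)\<close>, and let \<open>z = l + t\<close> be
  a point of \<open>M\<close> in \<open>conv S + conv T\<close>, with \<open>l \<in> L\<close> and \<open>t \<in> T\<close>. If \<open>l \<notin> conv S\<close>, a facet
  separates \<open>l\<close> from \<open>conv S\<close> (lemma \<open>facet_separates_point\<close>); if \<open>u\<close> is its outer normal vector,
  then \<open>\<langle>u,l\<rangle>\<close> exceeds \<open>max\<^sub>S u\<close> by at least 1, as both numbers are integers. So
  \<open>\<langle>u,z\<rangle> \<ge> max\<^sub>S u + 1 + min\<^sub>T u > max\<^sub>S u + max\<^sub>T u\<close>, which is impossible in \<open>conv S + conv T\<close>.
  Hence \<open>l \<in> conv S \<inter> L = S\<close>.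

  Conversely, suppose that \<open>S + T = C \<inter> M\<close> with \<open>C\<close> convex, and let \<open>F\<close> be a facet whose affine
  hull is covered by the \<open>L\<close>-translates of \<open>F\<close>. As \<open>F\<close> is spanned by points of \<open>L\<close>, it has an outer
  normal vector \<open>u\<close> that maps \<open>L\<close> onto the integers (lemma \<open>primitive_normal_vector\<close>). If
  \<open>w(T,u) \<ge> 1\<close>, take \<open>t\<^sub>0\<close> and \<open>t\<^sub>1\<close> in \<open>T\<close> with \<open>\<langle>u,t\<^sub>1 - t\<^sub>0\<rangle> \<ge> 1\<close> and a point \<open>p\<close> of the segment
  between them with \<open>\<langle>u,p - t\<^sub>0\<rangle> = 1\<close>. Some \<open>l \<in> L\<close> lies exactly one layer above \<open>aff F\<close>, and then
  \<open>t\<^sub>0 + l\<close> lies in \<open>aff F + p\<close>. Since \<open>aff F\<close> is covered by translates of \<open>F\<close>, a lattice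
  translate \<open>t\<^sub>0 + l - l'\<close> lies in \<open>F + p\<close>, a subset of \<open>conv (S + T)\<close> and so of \<open>C\<close>. It is also in
  \<open>M\<close>, hence in \<open>S + T\<close>, and uniqueness of the representation in \<open>L \<oplus> T\<close> yields
  \<open>l - l' \<in> S\<close>. But \<open>u\<close> is larger at \<open>l - l'\<close> than anywhere on \<open>S\<close>.
\<close>

section \<open>Lattices of full rank\<close>

lemma lattice_add:
  assumes "lattice_of_rank i L" "x \<in> L" "y \<in> L"
  shows "x + y \<in> L"
proof -
  obtain B where B: "L = {(\<Sum>b\<in>B. of_int (c b) *\<^sub>R b) | c :: 'a \<Rightarrow> int. True}"
    using assms(1) unfolding lattice_of_rank_def by blast
  obtain c d where "x = (\<Sum>b\<in>B. of_int (c b) *\<^sub>R b)" "y = (\<Sum>b\<in>B. of_int (d b) *\<^sub>R b)"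
    using assms(2,3) unfolding B by blast
  then have "x + y = (\<Sum>b\<in>B. of_int (c b + d b) *\<^sub>R b)"
    by (simp add: sum.distrib scaleR_left_distrib)
  then show ?thesis
    unfolding B mem_Collect_eq by (intro exI[of _ "\<lambda>b. c b + d b"]) simp
qed

lemma lattice_int_scale:
  assumes "lattice_of_rank i L" "x \<in> L"
  shows "of_int k *\<^sub>R x \<in> L"
proof -
  obtain B where B: "L = {(\<Sum>b\<in>B. of_int (c b) *\<^sub>R b) | c :: 'a \<Rightarrow> int. True}"
    using assms(1) unfolding lattice_of_rank_def by blast
  obtain c where "x = (\<Sum>b\<in>B. of_int (c b) *\<^sub>R b)"
    using assms(2) unfolding B by blast
  then have "of_int k *\<^sub>R x = (\<Sum>b\<in>B. of_int (k * c b) *\<^sub>R b)"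
    by (simp add: scaleR_sum_right)
  then show ?thesis
    unfolding B mem_Collect_eq by (intro exI[of _ "\<lambda>b. k * c b"]) simp
qed

lemma lattice_zero:
  assumes "lattice_of_rank i L"
  shows "0 \<in> L"
proof -
  obtain B where B: "L = {(\<Sum>b\<in>B. of_int (c b) *\<^sub>R b) | c :: 'a \<Rightarrow> int. True}"
    using assms unfolding lattice_of_rank_def by blast
  show ?thesis
    unfolding B mem_Collect_eq by (intro exI[of _ "\<lambda>b. 0"]) simp
qed

lemma lattice_diff:
  assumes "lattice_of_rank i L" "x \<in> L" "y \<in> L"
  shows "x - y \<in> L"
  using lattice_add[OF assms(1,2) lattice_int_scale[OF assms(1,3), of "-1"]] by simp

lemma lattice_int_combination:
  assumes "lattice_of_rank i L" "V \<subseteq> L"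
  shows "(\<Sum>v\<in>V. of_int (k v) *\<^sub>R v) \<in> L"
  using assms(2)
proof (induction V rule: infinite_finite_induct)
  case (insert v V)
  then show ?case
    by (simp add: lattice_add[OF assms(1)] lattice_int_scale[OF assms(1)])
qed (auto intro: lattice_zero[OF assms(1)])

lemma span_lattice_of_full_rank:
  fixes L :: "'a::euclidean_space set"
  assumes "lattice_of_rank DIM('a) L"
  shows "span L = UNIV"
proof -
  obtain B where fin: "finite B" and ind: "independent B" and card: "card B = DIM('a)"
    and B: "L = {(\<Sum>b\<in>B. of_int (c b) *\<^sub>R b) | c :: 'a \<Rightarrow> int. True}"
    using assms unfolding lattice_of_rank_def by blast
  have "b \<in> L" if "b \<in> B" for b
  proof -
    have "b = (\<Sum>b'\<in>B. of_int (if b' = b then 1 else 0) *\<^sub>R b')"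
      using fin that by (simp add: if_distrib[of "\<lambda>r. r *\<^sub>R _"] if_distrib[of of_int] cong: if_cong)
    then show ?thesis
      unfolding B mem_Collect_eq by (intro exI[of _ "\<lambda>b'. if b' = b then 1 else 0"]) simp
  qed
  then have "span B \<subseteq> span L"
    by (intro span_mono) blast
  moreover have "span B = UNIV"
    using card_eq_dim[of B UNIV] fin ind card by auto
  ultimately show ?thesis
    by blast
qed

text \<open>
  Each coordinate with respect to a basis is a linear, hence bounded, functional. So the integer
  coordinates of the lattice points of a ball are bounded.
\<close>

lemma finite_lattice_Int_cball:
  fixes L :: "'a::euclidean_space set"
  assumes "lattice_of_rank i L"
  shows "finite (L \<inter> cball 0 R)"
proof -
  obtain B where fin: "finite B" and ind: "independent B"
    and B: "L = {(\<Sum>b\<in>B. of_int (c b) *\<^sub>R b) | c :: 'a \<Rightarrow> int. True}"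
    using assms unfolding lattice_of_rank_def by blast
  have "\<exists>K::real. \<forall>c :: 'a \<Rightarrow> int.
      \<bar>of_int (c b)\<bar> \<le> K * norm (\<Sum>b\<in>B. of_int (c b) *\<^sub>R b)" if "b \<in> B" for b
  proof -
    obtain g :: "'a \<Rightarrow> real" where g: "linear g" "\<forall>x\<in>B. g x = (if x = b then 1 else 0)"
      using linear_independent_extend[OF ind, of "\<lambda>x. if x = b then 1 else 0 :: real"] by blast
    obtain K where K: "\<And>x. norm (g x) \<le> norm x * K"
      using linear_conv_bounded_linear g(1) bounded_linear.bounded by blast
    have "g (\<Sum>b\<in>B. of_int (c b) *\<^sub>R b) = of_int (c b)" for c :: "'a \<Rightarrow> int"
      using g(2) fin that
      by (simp add: linear_sum[OF g(1)] linear_scale[OF g(1)] if_distrib[of "\<lambda>r. _ * r"] cong: if_cong)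
    then show ?thesis
      using K by (intro exI[of _ K]) (metis mult.commute real_norm_def)
  qed
  then obtain K :: "'a \<Rightarrow> real" where K: "\<And>b (c :: 'a \<Rightarrow> int). b \<in> B \<Longrightarrow>
      \<bar>of_int (c b)\<bar> \<le> K b * norm (\<Sum>b\<in>B. of_int (c b) *\<^sub>R b)"
    by metis
  define I where "I = Pi\<^sub>E B (\<lambda>b. {-\<lceil>\<bar>K b\<bar> * R\<rceil>..\<lceil>\<bar>K b\<bar> * R\<rceil>})"
  have "L \<inter> cball 0 R \<subseteq> (\<lambda>c. \<Sum>b\<in>B. of_int (c b) *\<^sub>R b) ` I"
  proof
    fix x assume x: "x \<in> L \<inter> cball 0 R"
    then obtain c where c: "x = (\<Sum>b\<in>B. of_int (c b) *\<^sub>R b)"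
      unfolding B by blast
    have "\<bar>c b\<bar> \<le> \<lceil>\<bar>K b\<bar> * R\<rceil>" if "b \<in> B" for b
    proof -
      have "\<bar>of_int (c b)\<bar> \<le> K b * norm x"
        using K[OF that] c by simp
      also have "\<dots> \<le> \<bar>K b\<bar> * R"
        using x by (intro mult_mono) auto
      finally show ?thesis
        by linarith
    qed
    then have "restrict c B \<in> I"
      unfolding I_def by (force simp: abs_le_iff)
    moreover have "x = (\<Sum>b\<in>B. of_int (restrict c B b) *\<^sub>R b)"
      using c by simp
    ultimately show "x \<in> (\<lambda>c. \<Sum>b\<in>B. of_int (c b) *\<^sub>R b) ` I"
      by blast
  qed
  moreover have "finite I"
    unfolding I_def using fin by (intro finite_PiE) auto
  ultimately show ?thesis
    by (meson finite_imageI finite_subset)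
qed

text \<open>
  The values \<open>\<langle>a,l\<rangle>\<close> with \<open>l \<in> L\<close> form a subgroup of the reals, and the point is that it is
  discrete: modulo the lattice vectors \<open>V\<close>, which do not change the value, every \<open>l\<close> with value
  in a bounded interval can be moved into a fixed ball, and the ball contains only finitely many
  lattice points. Dividing \<open>a\<close> by the generator of the group gives the normal vector.
\<close>

lemma primitive_normal_vector:
  fixes L :: "'a::euclidean_space set"
  assumes L: "lattice_of_rank DIM('a) L"
    and V: "finite V" "V \<subseteq> L" "span V = {x. a \<bullet> x = 0}"
    and a: "a \<noteq> 0"
  obtains \<gamma> l where "\<gamma> > 0" "l \<in> L" "(a /\<^sub>R \<gamma>) \<bullet> l = 1" "a /\<^sub>R \<gamma> \<in> dual_lattice L"
proof -
  have "\<exists>b\<in>L. a \<bullet> b \<noteq> 0"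
  proof (rule ccontr)
    assume "\<not> ?thesis"
    then have "L \<subseteq> {x. a \<bullet> x = 0}"
      by blast
    then have "span L \<subseteq> {x. a \<bullet> x = 0}"
      using subspace_hyperplane span_minimal by blast
    then have "a \<bullet> a = 0"
      using span_lattice_of_full_rank[OF L] by blast
    with a show False
      by simp
  qed
  then obtain b' where b': "b' \<in> L" "a \<bullet> b' \<noteq> 0"
    by blast
  obtain b where b: "b \<in> L" "a \<bullet> b > 0"
  proof (cases "a \<bullet> b' > 0")
    case False
    then show ?thesis
      using that[of "- b'"] lattice_int_scale[OF L b'(1), of "-1"] b'(2) by simp
  qed (use b' that in blast)
  define R where "R = norm b + (\<Sum>v\<in>V. norm v)"
  define G where "G = {a \<bullet> l | l. l \<in> L \<and> 0 < a \<bullet> l \<and> a \<bullet> l \<le> a \<bullet> b}"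
  have "G \<subseteq> (\<lambda>l. a \<bullet> l) ` (L \<inter> cball 0 R)"
  proof
    fix g assume "g \<in> G"
    then obtain l where l: "l \<in> L" "0 < a \<bullet> l" "a \<bullet> l \<le> a \<bullet> b" "g = a \<bullet> l"
      unfolding G_def by blast
    define q where "q = (a \<bullet> l) / (a \<bullet> b)"
    have q: "0 \<le> q" "q \<le> 1"
      using l b by (auto simp: q_def field_simps)
    have "a \<bullet> (l - q *\<^sub>R b) = 0"
      using b by (simp add: q_def inner_diff_right)
    then have "l - q *\<^sub>R b \<in> span V"
      using V(3) by blast
    then obtain r where r: "l - q *\<^sub>R b = (\<Sum>v\<in>V. r v *\<^sub>R v)"
      using span_finite[OF V(1)] by auto
    define l' where "l' = l - (\<Sum>v\<in>V. of_int \<lfloor>r v\<rfloor> *\<^sub>R v)"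
    have "l' \<in> L"
      unfolding l'_def by (intro lattice_diff[OF L l(1)] lattice_int_combination[OF L V(2)])
    moreover have "a \<bullet> l' = g"
    proof -
      have "a \<bullet> v = 0" if "v \<in> V" for v
        using that V(3) span_base[of v V] by blast
      then show ?thesis
        by (simp add: l'_def inner_diff_right inner_sum_right l)
    qed
    moreover have "norm l' \<le> R"
    proof -
      have "l' = q *\<^sub>R b + (\<Sum>v\<in>V. frac (r v) *\<^sub>R v)"
        using r by (simp add: l'_def frac_def scaleR_left_diff_distrib sum_subtractf algebra_simps)
      then have "norm l' \<le> norm (q *\<^sub>R b) + norm (\<Sum>v\<in>V. frac (r v) *\<^sub>R v)"
        using norm_triangle_ineq by metis
      also have "\<dots> \<le> norm b + (\<Sum>v\<in>V. norm v)"
      proof (rule add_mono)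
        show "norm (q *\<^sub>R b) \<le> norm b"
          using q by (simp add: mult_left_le_one_le)
        show "norm (\<Sum>v\<in>V. frac (r v) *\<^sub>R v) \<le> (\<Sum>v\<in>V. norm v)"
          by (rule sum_norm_le)
            (simp add: mult_left_le_one_le frac_ge_0 less_imp_le[OF frac_lt_1])
      qed
      finally show ?thesis
        unfolding R_def .
    qed
    ultimately show "g \<in> (\<lambda>l. a \<bullet> l) ` (L \<inter> cball 0 R)"
      by force
  qed
  then have finG: "finite G"
    using finite_lattice_Int_cball[OF L] by (meson finite_imageI finite_subset)
  have "a \<bullet> b \<in> G"
    unfolding G_def using b by blast
  define \<gamma> where "\<gamma> = Min G"
  have "\<gamma> \<in> G"
    unfolding \<gamma>_def using Min_in[OF finG] \<open>a \<bullet> b \<in> G\<close> by blast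
  then obtain l where l: "l \<in> L" "\<gamma> = a \<bullet> l" "0 < \<gamma>" "\<gamma> \<le> a \<bullet> b"
    unfolding G_def by blast
  have multiple: "\<exists>k. a \<bullet> x = of_int k * \<gamma>" if "x \<in> L" for x
  proof -
    define k where "k = \<lfloor>(a \<bullet> x) / \<gamma>\<rfloor>"
    define y where "y = x - of_int k *\<^sub>R l"
    have "y \<in> L"
      unfolding y_def by (intro lattice_diff[OF L that] lattice_int_scale[OF L l(1)])
    have y: "a \<bullet> y = a \<bullet> x - of_int k * \<gamma>"
      by (simp add: y_def inner_diff_right l(2))
    have "of_int k \<le> (a \<bullet> x) / \<gamma>" "(a \<bullet> x) / \<gamma> < of_int k + 1"
      unfolding k_def by linarith+
    then have "0 \<le> a \<bullet> y" "a \<bullet> y < \<gamma>"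
      using y l(3) by (auto simp: field_simps)
    (* A positive remainder would be an element of G below its minimum. *)
    moreover have "\<not> 0 < a \<bullet> y"
    proof
      assume "0 < a \<bullet> y"
      then have "a \<bullet> y \<in> G"
        unfolding G_def using \<open>y \<in> L\<close> \<open>a \<bullet> y < \<gamma>\<close> l(4) by force
      then have "\<gamma> \<le> a \<bullet> y"
        unfolding \<gamma>_def using finG by simp
      with \<open>a \<bullet> y < \<gamma>\<close> show False
        by simp
    qed
    ultimately show ?thesis
      using y by (intro exI[of _ k]) simp
  qed
  show ?thesis
  proof
    show "0 < \<gamma>" "l \<in> L"
      by fact+
    show "(a /\<^sub>R \<gamma>) \<bullet> l = 1"
      using l by simp
    show "a /\<^sub>R \<gamma> \<in> dual_lattice L"
      unfolding dual_lattice_def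
    proof (intro CollectI ballI)
      fix x assume "x \<in> L"
      then obtain k where "a \<bullet> x = of_int k * \<gamma>"
        using multiple by blast
      then have "(a /\<^sub>R \<gamma>) \<bullet> x = of_int k"
        using l(3) by simp
      then show "(a /\<^sub>R \<gamma>) \<bullet> x \<in> \<int>"
        by simp
    qed
  qed
qed

section \<open>Facets of full-dimensional polyhedra and their normal vectors\<close>

lemma facet_hyperplane:
  fixes P :: "'a::euclidean_space set"
  assumes "polyhedron P" "aff_dim P = int DIM('a)" "F facet_of P"
  obtains a b where "a \<noteq> 0" "P \<subseteq> {x. a \<bullet> x \<le> b}" "F = P \<inter> {x. a \<bullet> x = b}"
    "affine hull F = {x. a \<bullet> x = b}"
proof -
  have F: "F face_of P" "F \<noteq> {}" "aff_dim F = int DIM('a) - 1"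
    using assms unfolding facet_of_def by auto
  then have "F exposed_face_of P" "F \<noteq> P"
    using assms exposed_face_of_polyhedron by auto
  then obtain a b where ab: "a \<noteq> 0" "P \<subseteq> {x. a \<bullet> x \<le> b}" "F = P \<inter> {x. a \<bullet> x = b}"
    using F(2) unfolding exposed_face_of by blast
  have "aff_dim F = aff_dim {x. a \<bullet> x = b}"
    using F(3) ab(1) by simp
  then have "affine hull F = affine hull {x. a \<bullet> x = b}"
    using aff_dim_eq_full_gen[of F "{x. a \<bullet> x = b}"] ab(3) by blast
  then have "affine hull F = {x. a \<bullet> x = b}"
    by (simp add: affine_hull_eq affine_hyperplane)
  with ab that show ?thesis
    by blast
qed

text \<open>
  The segment from an interior point of \<open>P\<close> to \<open>z\<close> leaves \<open>P\<close> through a facet, whose supporting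
  hyperplane is thereby crossed.
\<close>

lemma facet_separates_point:
  fixes P :: "'a::euclidean_space set"
  assumes P: "polyhedron P" "aff_dim P = int DIM('a)" and z: "z \<notin> P"
  obtains F a b where "F facet_of P" "a \<noteq> 0" "P \<subseteq> {x. a \<bullet> x \<le> b}" "F = P \<inter> {x. a \<bullet> x = b}"
    "affine hull F = {x. a \<bullet> x = b}" "b < a \<bullet> z"
proof -
  have convex: "convex P" and closed: "closed P"
    using P polyhedron_imp_convex polyhedron_imp_closed by blast+
  have int: "rel_interior P = interior P"
    using P(2) by (simp add: interior_rel_interior_gen)
  have "P \<noteq> {}"
    using P(2) by force
  then obtain y where y: "y \<in> interior P"
    using int rel_interior_eq_empty[OF convex] by blast
  have "y \<in> closed_segment y z \<inter> P" "z \<in> closed_segment y z - P"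
    using y z interior_subset by auto
  then have "closed_segment y z \<inter> frontier P \<noteq> {}"
    by (intro connected_Int_frontier) auto
  then obtain p where p: "p \<in> closed_segment y z" "p \<in> frontier P"
    by blast
  then have "p \<in> rel_frontier P"
    by (simp add: rel_frontier_def frontier_def int)
  then obtain F where F: "F facet_of P" "p \<in> F"
    using rel_frontier_of_polyhedron[OF P(1)] by blast
  obtain a b where ab: "a \<noteq> 0" "P \<subseteq> {x. a \<bullet> x \<le> b}" "F = P \<inter> {x. a \<bullet> x = b}"
    "affine hull F = {x. a \<bullet> x = b}"
    using facet_hyperplane[OF P F(1)] by blast
  have "interior P \<subseteq> {x. a \<bullet> x < b}"
    using interior_mono[OF ab(2)] ab(1) by simp
  with y have "a \<bullet> y < b"
    by blast
  obtain s where s: "0 \<le> s" "s \<le> 1" "p = (1 - s) *\<^sub>R y + s *\<^sub>R z"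
    using p(1) unfolding in_segment by blast
  have "p \<in> P"
    using F(2) ab(3) by blast
  then have "s \<noteq> 1"
    using s(3) z by auto
  with s have "s < 1"
    by simp
  have "b < a \<bullet> z"
  proof (rule ccontr)
    assume "\<not> ?thesis"
    then have "s * (a \<bullet> z) \<le> s * b"
      using s(1) by (simp add: mult_left_mono)
    moreover have "(1 - s) * (a \<bullet> y) < (1 - s) * b"
      using \<open>a \<bullet> y < b\<close> \<open>s < 1\<close> by simp
    moreover have "(1 - s) * (a \<bullet> y) + s * (a \<bullet> z) = b"
      using F(2) ab(3) s(3) by (simp add: inner_add_right)
    ultimately show False
      by (simp add: algebra_simps)
  qed
  with F ab that show ?thesis
    by blast
qed

lemma normal_vector_unique:
  fixes a :: "'a::euclidean_space"
  assumes aff: "affine hull F = {x. a \<bullet> x = b}" and a: "a \<noteq> 0" and u: "normal_vector F u"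
  obtains c where "c \<noteq> 0" "u = c *\<^sub>R a"
proof -
  have "(b / (a \<bullet> a)) *\<^sub>R a \<in> {x. a \<bullet> x = b}"
    using a by simp
  then have "F \<noteq> {}"
    using aff by (metis affine_hull_empty empty_iff)
  then obtain f where f: "f \<in> F"
    by blast
  have "F \<subseteq> {x. u \<bullet> x = u \<bullet> f}"
  proof
    fix x assume "x \<in> F"
    then have "u \<bullet> (x - f) = 0"
      using u f unfolding normal_vector_def by blast
    then show "x \<in> {x. u \<bullet> x = u \<bullet> f}"
      by (simp add: inner_diff_right)
  qed
  then have const: "affine hull F \<subseteq> {x. u \<bullet> x = u \<bullet> f}"
    by (simp add: hull_minimal affine_hyperplane)
  define c where "c = (a \<bullet> u) / (a \<bullet> a)"
  (* The component of u parallel to the hyperplane, on which u vanishes. *)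
  define w where "w = u - c *\<^sub>R a"
  have aw: "a \<bullet> w = 0"
    using a by (simp add: w_def c_def inner_diff_right)
  have "f \<in> affine hull F"
    using f by (rule hull_inc)
  then have "f + w \<in> affine hull F"
    unfolding aff using aw by (simp add: inner_add_right)
  then have "u \<bullet> w = 0"
    using const by (auto simp: inner_add_right)
  then have "w \<bullet> w = 0"
    using aw by (simp add: w_def inner_diff_left)
  then have "u = c *\<^sub>R a"
    by (simp add: w_def)
  moreover have "c \<noteq> 0"
    using u calculation unfolding normal_vector_def by auto
  ultimately show ?thesis
    using that by blast
qed

text \<open>
  The facet is the convex hull of a subset of \<open>S\<close>, so differences of points of \<open>S\<close> span its
  direction space.
\<close>

lemma facet_primitive_normal_vector:
  fixes S L :: "'a::euclidean_space set"
  assumes L: "lattice_of_rank DIM('a) L" and S: "finite S" "S \<subseteq> L" "aff_dim S = int DIM('a)"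
    and F: "F facet_of (convex hull S)"
  obtains u \<beta> l s where "u \<in> dual_lattice L" "u \<noteq> 0" "normal_vector F u" "l \<in> L" "u \<bullet> l = 1"
    "convex hull S \<subseteq> {x. u \<bullet> x \<le> \<beta>}" "affine hull F = {x. u \<bullet> x = \<beta>}" "s \<in> S" "u \<bullet> s = \<beta>"
proof -
  have "polyhedron (convex hull S)" "aff_dim (convex hull S) = int DIM('a)"
    using S by (auto simp: polyhedron_convex_hull aff_dim_convex_hull)
  then obtain a b where ab: "a \<noteq> 0" "convex hull S \<subseteq> {x. a \<bullet> x \<le> b}"
    "F = convex hull S \<inter> {x. a \<bullet> x = b}" "affine hull F = {x. a \<bullet> x = b}"
    using facet_hyperplane F by blast
  have "F face_of (convex hull S)" "F \<noteq> {}"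
    using F unfolding facet_of_def by auto
  then obtain S' where S': "S' \<subseteq> S" "F = convex hull S'"
    using face_of_convex_hull_subset finite_imp_compact S(1) by metis
  then obtain s where s: "s \<in> S'"
    using \<open>F \<noteq> {}\<close> by fastforce
  then have "s \<in> F"
    using S'(2) hull_inc by metis
  have aff: "affine hull S' = {x. a \<bullet> x = b}"
    using ab(4) S'(2) by simp
  define V where "V = (\<lambda>x. -s + x) ` S'"
  have "finite V"
    unfolding V_def using S' S(1) finite_subset by blast
  moreover have "V \<subseteq> L"
    unfolding V_def using S'(1) S(2) s lattice_diff[OF L] by fastforce
  moreover have "span V = {x. a \<bullet> x = 0}"
  proof -
    have *: "{x. a \<bullet> x = b} = (\<lambda>x. s + x) ` span V"
      unfolding V_def using affine_hull_span_gen[OF hull_inc[OF s]] aff by argo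
    have "a \<bullet> s = b"
      using \<open>s \<in> F\<close> ab(3) by blast
    have "x \<in> span V \<longleftrightarrow> s + x \<in> {x. a \<bullet> x = b}" for x
      unfolding * by auto
    then show ?thesis
      using \<open>a \<bullet> s = b\<close> by (auto simp: inner_add_right)
  qed
  ultimately obtain \<gamma> l where \<gamma>: "\<gamma> > 0" "l \<in> L" "(a /\<^sub>R \<gamma>) \<bullet> l = 1" "a /\<^sub>R \<gamma> \<in> dual_lattice L"
    using primitive_normal_vector[OF L] ab(1) by metis
  show ?thesis
  proof
    show "a /\<^sub>R \<gamma> \<noteq> 0"
      using \<gamma>(1) ab(1) by simp
    then show "normal_vector F (a /\<^sub>R \<gamma>)"
      unfolding normal_vector_def ab(3) by (auto simp: inner_diff_right)
    show "convex hull S \<subseteq> {x. (a /\<^sub>R \<gamma>) \<bullet> x \<le> b / \<gamma>}"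
      using ab(2) \<gamma>(1) by (auto simp: divide_simps)
    show "affine hull F = {x. (a /\<^sub>R \<gamma>) \<bullet> x = b / \<gamma>}"
      using ab(4) \<gamma>(1) by (auto simp: divide_simps)
    show "s \<in> S"
      using s S'(1) by blast
    show "(a /\<^sub>R \<gamma>) \<bullet> s = b / \<gamma>"
      using \<open>s \<in> F\<close> ab(3) \<gamma>(1) by (auto simp: divide_simps)
  qed (fact \<gamma>)+
qed

section \<open>Width and direct sums\<close>

lemma inner_diff_le_width:
  assumes "finite T" "x \<in> T" "y \<in> T"
  shows "u \<bullet> (x - y) \<le> width T u"
proof -
  have "u \<bullet> x \<le> (SUP x\<in>T. u \<bullet> x)" "(INF x\<in>T. u \<bullet> x) \<le> u \<bullet> y"
    using assms by (auto intro!: cSUP_upper cINF_lower)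
  then show ?thesis
    unfolding width_def by (simp add: inner_diff_right)
qed

lemma width_attained:
  assumes "finite T" "T \<noteq> {}"
  obtains x y where "x \<in> T" "y \<in> T" "width T u = u \<bullet> (x - y)"
proof -
  have "(SUP x\<in>T. u \<bullet> x) \<in> (\<lambda>x. u \<bullet> x) ` T" "(INF x\<in>T. u \<bullet> x) \<in> (\<lambda>x. u \<bullet> x) ` T"
    using assms by (simp_all add: cSup_eq_Max cInf_eq_Min)
  then show ?thesis
    using that unfolding width_def by (force simp: inner_diff_right)
qed

lemma width_uminus: "width T (- u) = width T u"
proof -
  have "(INF x\<in>T. - u \<bullet> x) = - (SUP x\<in>T. u \<bullet> x)" "(INF x\<in>T. u \<bullet> x) = - (SUP x\<in>T. - u \<bullet> x)"
    unfolding Inf_real_def by (simp_all add: image_image)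
  then show ?thesis
    unfolding width_def by simp
qed

lemma direct_sum_unique:
  assumes "direct_sum X Y" "x \<in> X" "y \<in> Y" "x' \<in> X" "y' \<in> Y" "x + y = x' + y'"
  shows "x = x' \<and> y = y'"
proof -
  have "x + y \<in> X + Y"
    using assms by blast
  then have "\<exists>!(p, q). p \<in> X \<and> q \<in> Y \<and> x + y = p + q"
    using assms(1) unfolding direct_sum_def by blast
  then obtain w where "\<And>v. (case v of (p, q) \<Rightarrow> p \<in> X \<and> q \<in> Y \<and> x + y = p + q) \<Longrightarrow> v = w"
    by (elim ex1E) blast
  from this[of "(x, y)"] this[of "(x', y')"] show ?thesis
    using assms(2-6) by force
qed

lemma direct_sum_subset:
  assumes "direct_sum X Y" "X' \<subseteq> X"
  shows "direct_sum X' Y"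
  unfolding direct_sum_def
proof
  fix z assume "z \<in> X' + Y"
  then obtain x y where xy: "x \<in> X'" "y \<in> Y" "z = x + y"
    by (rule set_plus_elim)
  show "\<exists>!(x, y). x \<in> X' \<and> y \<in> Y \<and> z = x + y"
  proof (rule ex1I[of _ "(x, y)"])
    fix v assume "case v of (x', y') \<Rightarrow> x' \<in> X' \<and> y' \<in> Y \<and> z = x' + y'"
    then obtain x' y' where v: "v = (x', y')" "x' \<in> X'" "y' \<in> Y" "z = x' + y'"
      by blast
    have "x' \<in> X" "x \<in> X" "x' + y' = x + y"
      using v xy assms(2) by auto
    then show "v = (x, y)"
      using direct_sum_unique[OF assms(1)] v xy by auto
  qed (use xy in simp)
qed

section \<open>Lattice-convexity of the sum\<close>

lemma lattice_convex_iff: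
  "lattice_convex M K \<longleftrightarrow> K = convex hull K \<inter> M"
proof
  assume "lattice_convex M K"
  then obtain C where C: "convex C" "K = C \<inter> M"
    unfolding lattice_convex_def by blast
  then have "convex hull K \<subseteq> C"
    by (simp add: hull_minimal)
  then show "K = convex hull K \<inter> M"
    using C(2) hull_subset[of K convex] by blast
next
  assume "K = convex hull K \<inter> M"
  then show "lattice_convex M K"
    unfolding lattice_convex_def by (intro exI[of _ "convex hull K"]) simp
qed

lemma lattice_convex_sum_of_small_width_facets:
  fixes L T S :: "'a::euclidean_space set"
  assumes T: "finite T" and S: "finite S" "S \<subseteq> L" "aff_dim S = int DIM('a)"
    and conv: "lattice_convex L S"
    and facets: "\<And>F. F facet_of (convex hull S) \<Longrightarrow> \<exists>u \<in> small_width_dual T L. normal_vector F u"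
  shows "lattice_convex (L + T) (S + T)"
proof -
  have "l \<in> convex hull S" if l: "l \<in> L" and t: "t \<in> T" and z: "l + t \<in> convex hull (S + T)" for l t
  proof (rule ccontr)
    assume "l \<notin> convex hull S"
    moreover have "polyhedron (convex hull S)" "aff_dim (convex hull S) = int DIM('a)"
      using S by (auto simp: polyhedron_convex_hull aff_dim_convex_hull)
    ultimately obtain F a b where F: "F facet_of (convex hull S)" "a \<noteq> 0"
      "convex hull S \<subseteq> {x. a \<bullet> x \<le> b}" "affine hull F = {x. a \<bullet> x = b}" "b < a \<bullet> l"
      "F = convex hull S \<inter> {x. a \<bullet> x = b}"
      using facet_separates_point by metis
    obtain u where u: "u \<in> small_width_dual T L" "normal_vector F u"
      using facets F(1) by blast
    obtain c where c: "c \<noteq> 0" "u = c *\<^sub>R a"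
      using normal_vector_unique[OF F(4,2) u(2)] by blast
    (* The outer one of the two normal vectors u and -u. *)
    define v where "v = \<bar>c\<bar> *\<^sub>R a"
    have "v = u \<or> v = - u"
      using c by (auto simp: v_def abs_if)
    then have v: "v \<in> dual_lattice L" "width T v < 1"
      using u(1) unfolding small_width_dual_def dual_lattice_def by (auto simp: width_uminus)
    obtain S' where S': "S' \<subseteq> S" "F = convex hull S'"
      using F(1) face_of_convex_hull_subset[of S F] finite_imp_compact[OF S(1)]
      unfolding facet_of_def by metis
    obtain s where s: "s \<in> S" "s \<in> F"
    proof -
      have "S' \<noteq> {}"
        using S'(2) F(1) unfolding facet_of_def by auto
      then show ?thesis
        using S' that hull_subset[of S' convex] by blast
    qed
    have le: "v \<bullet> x \<le> v \<bullet> s" if "x \<in> convex hull S" for x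
      using that F(3,6) s(2) by (auto simp: v_def intro!: mult_left_mono)
    have "v \<bullet> s < v \<bullet> l"
      using F(5,6) s(2) c(1) by (auto simp: v_def)
    moreover have "v \<bullet> s \<in> \<int>" "v \<bullet> l \<in> \<int>"
      using v(1) s(1) S(2) l unfolding dual_lattice_def by auto
    ultimately have gap: "v \<bullet> s + 1 \<le> v \<bullet> l"
      by (auto elim!: Ints_cases)
    obtain x y where xy: "x \<in> convex hull S" "y \<in> convex hull T" "l + t = x + y"
      using z unfolding convex_hull_set_plus by (rule set_plus_elim)
    have "T \<subseteq> {y. v \<bullet> y \<le> v \<bullet> t + width T v}"
      using inner_diff_le_width[OF T _ t, of _ v] by (force simp: inner_diff_right)
    then have "convex hull T \<subseteq> {y. v \<bullet> y \<le> v \<bullet> t + width T v}"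
      by (simp add: hull_minimal convex_halfspace_le)
    then have "v \<bullet> y \<le> v \<bullet> t + width T v"
      using xy(2) by blast
    moreover have "v \<bullet> l + v \<bullet> t = v \<bullet> x + v \<bullet> y"
      using xy(3) by (metis inner_add_right)
    ultimately show False
      using le[OF xy(1)] gap v(2) by linarith
  qed
  moreover have "S = convex hull S \<inter> L"
    using conv by (simp add: lattice_convex_iff)
  ultimately have "convex hull (S + T) \<inter> (L + T) \<subseteq> S + T"
    by (blast elim!: set_plus_elim)
  moreover have "S + T \<subseteq> convex hull (S + T) \<inter> (L + T)"
    using hull_subset[of "S + T" convex] set_plus_mono2[OF S(2) order_refl] by blast
  ultimately show ?thesis
    by (simp add: lattice_convex_iff subset_antisym)
qed

text \<open>
  Adding one fixed point of \<open>T\<close> carries a lattice point of \<open>conv S\<close> into \<open>S + T\<close>, where the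
  uniqueness of the representation in \<open>L \<oplus> T\<close> recovers it as a point of \<open>S\<close>.
\<close>

lemma lattice_convex_of_lattice_convex_sum:
  fixes L T S :: "'a::real_vector set"
  assumes "T \<noteq> {}" "S \<subseteq> L" and direct: "direct_sum L T" and sum: "lattice_convex (L + T) (S + T)"
  shows "lattice_convex L S"
proof -
  have "l \<in> S" if l: "l \<in> convex hull S" "l \<in> L" for l
  proof -
    obtain t where t: "t \<in> T"
      using assms(1) by blast
    have "l + t \<in> convex hull (S + T) \<inter> (L + T)"
      using l t by (auto simp: convex_hull_set_plus hull_inc)
    then have "l + t \<in> S + T"
      using sum lattice_convex_iff by blast
    then obtain s t' where st: "s \<in> S" "t' \<in> T" "l + t = s + t'"
      by (rule set_plus_elim)
    then have "l = s"
      using direct_sum_unique[OF direct l(2) t _ st(2)] assms(2) by blast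
    with st show ?thesis
      by simp
  qed
  then have "S = convex hull S \<inter> L"
    using assms(2) hull_subset[of S convex] by blast
  then show ?thesis
    by (simp add: lattice_convex_iff)
qed

lemma small_width_of_lattice_convex_sum:
  fixes L T S :: "'a::euclidean_space set"
  assumes L: "lattice_of_rank DIM('a) L" and T: "finite T" "T \<noteq> {}"
    and S: "finite S" "S \<subseteq> L" "aff_dim S = int DIM('a)"
    and direct: "direct_sum L T" and sum: "lattice_convex (L + T) (S + T)"
    and F: "F facet_of (convex hull S)" and cover: "affine hull F \<subseteq> F + L"
  shows "\<exists>u \<in> small_width_dual T L. normal_vector F u"
proof -
  obtain u \<beta> l\<^sub>1 s where u: "u \<in> dual_lattice L" "u \<noteq> 0" "normal_vector F u"
    and l\<^sub>1: "l\<^sub>1 \<in> L" "u \<bullet> l\<^sub>1 = 1" and max: "convex hull S \<subseteq> {x. u \<bullet> x \<le> \<beta>}"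
    and aff: "affine hull F = {x. u \<bullet> x = \<beta>}" and s: "s \<in> S" "u \<bullet> s = \<beta>"
    by (rule facet_primitive_normal_vector[OF L S F])
  have "width T u < 1"
  proof (rule ccontr)
    assume "\<not> ?thesis"
    then have wide: "1 \<le> width T u"
      by simp
    obtain t\<^sub>1 t\<^sub>0 where t: "t\<^sub>1 \<in> T" "t\<^sub>0 \<in> T" "width T u = u \<bullet> (t\<^sub>1 - t\<^sub>0)"
      using width_attained[OF T] by metis
    (* The point p lies one unit above t0 in direction u, within the segment since the width is
       at least 1. *)
    define q where "q = 1 / width T u"
    define p where "p = (1 - q) *\<^sub>R t\<^sub>0 + q *\<^sub>R t\<^sub>1"
    have q: "0 \<le> q" "q \<le> 1"
      using wide by (auto simp: q_def)
    have "p \<in> convex hull T"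
      unfolding p_def using t q by (intro convexD_alt) (auto simp: hull_inc)
    have "p = t\<^sub>0 + q *\<^sub>R (t\<^sub>1 - t\<^sub>0)"
      by (simp add: p_def algebra_simps)
    then have p: "u \<bullet> p = u \<bullet> t\<^sub>0 + 1"
      using wide by (simp add: inner_add_right q_def flip: t(3))
    define l where "l = s + l\<^sub>1"
    have l: "l \<in> L" "u \<bullet> l = \<beta> + 1"
      using lattice_add[OF L] s S(2) l\<^sub>1 by (auto simp: l_def inner_add_right)
    have "t\<^sub>0 + l - p \<in> affine hull F"
      unfolding aff using p l by (simp add: inner_diff_right inner_add_right)
    then have "t\<^sub>0 + l - p \<in> F + L"
      using cover by blast
    then obtain f l' where f: "f \<in> F" "l' \<in> L" "t\<^sub>0 + l - p = f + l'"
      by (rule set_plus_elim)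
    have "u \<bullet> f = \<beta>"
      using hull_inc[OF f(1), of affine] aff by blast
    moreover have "u \<bullet> (t\<^sub>0 + l - p) = \<beta>"
      using p l by (simp add: inner_diff_right inner_add_right)
    ultimately have l': "u \<bullet> l' = 0"
      using f(3) by (simp add: inner_add_right)
    have diff: "l - l' \<in> L"
      using lattice_diff[OF L l(1) f(2)] .
    have "F \<subseteq> convex hull S"
      using F by (simp add: facet_of_imp_subset)
    then have "f + p \<in> convex hull (S + T)"
      using f(1) \<open>p \<in> convex hull T\<close> unfolding convex_hull_set_plus by blast
    moreover have "f + p = (l - l') + t\<^sub>0"
      using f(3) by (simp add: algebra_simps)
    ultimately have "(l - l') + t\<^sub>0 \<in> convex hull (S + T) \<inter> (L + T)"
      using diff t(2) by auto
    then have "(l - l') + t\<^sub>0 \<in> S + T"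
      using sum lattice_convex_iff by blast
    then obtain s' t' where st: "s' \<in> S" "t' \<in> T" "(l - l') + t\<^sub>0 = s' + t'"
      by (rule set_plus_elim)
    then have "l - l' = s'"
      using direct_sum_unique[OF direct diff t(2) _ st(2)] S(2) by blast
    then have "u \<bullet> s' = \<beta> + 1"
      using l(2) l' by (auto simp: inner_diff_right)
    moreover have "u \<bullet> s' \<le> \<beta>"
      using max hull_inc[OF st(1)] by blast
    ultimately show False
      by simp
  qed
  with u show ?thesis
    unfolding small_width_dual_def by blast
qed

theorem theorem2p1:
  fixes M L T S :: "(real ^ 'n) set"
  assumes "(M, L, T) \<in> tiling_triples"
    and "finite S" and "S \<subseteq> L" and "aff_dim S = int CARD('n)"
  shows
    "((lattice_convex L S \<and>
        (\<forall>F. F facet_of (convex hull S) \<longrightarrow> (\<exists>u \<in> small_width_dual T L. normal_vector F u)))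
      \<longrightarrow> (direct_sum S T \<and> lattice_convex M (S + T)))
    \<and>
     ((direct_sum S T \<and> lattice_convex M (S + T))
      \<longrightarrow> (lattice_convex L S \<and>
        (\<forall>F. F facet_of (convex hull S) \<and> affine hull F \<subseteq> F + L \<longrightarrow>
          (\<exists>u \<in> small_width_dual T L. normal_vector F u))))"
proof -
  have L: "lattice_of_rank DIM(real ^ 'n) L" and T: "finite T" "T \<noteq> {}"
    and direct: "direct_sum L T" and M: "M = L + T"
    using assms(1) unfolding tiling_triples_def by auto
  have dim: "aff_dim S = int DIM(real ^ 'n)"
    using assms(4) by simp
  show ?thesis
    unfolding M
  proof (intro conjI impI allI; elim conjE)
    assume "lattice_convex L S"
      "\<forall>F. F facet_of (convex hull S) \<longrightarrow> (\<exists>u \<in> small_width_dual T L. normal_vector F u)"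
    then show "lattice_convex (L + T) (S + T)"
      by (intro lattice_convex_sum_of_small_width_facets[OF T(1) assms(2,3) dim]) auto
    show "direct_sum S T"
      by (rule direct_sum_subset[OF direct assms(3)])
  next
    assume sum: "lattice_convex (L + T) (S + T)"
    show "lattice_convex L S"
      by (rule lattice_convex_of_lattice_convex_sum[OF T(2) assms(3) direct sum])
    show "\<exists>u \<in> small_width_dual T L. normal_vector F u"
      if "F facet_of (convex hull S)" "affine hull F \<subseteq> F + L" for F
      by (rule small_width_of_lattice_convex_sum[OF L T assms(2,3) dim direct sum that])
  qed
qed

end
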